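(* There is a one-to-one correspondence between Manin triples of Leibniz algebras associated to the nondegenerate symmetric left-invariant bilinear forms and Manin triples of special type-$a$ pre-Leibniz algebras.
   Context: All vector spaces are finite-dimensional over an algebraically closed field $\mathbb{K}$ of characteristic zero. A Leibniz algebra is a vector space $A$ with a bilinear multiplication $\circ_A$ such that $x\circ_A(y\circ_A z)=(x\circ_A y)\circ_A z+y\circ_A(x\circ_A z)$ for all $x,y,z\in A$. A bilinear form $\mathcal{B}$ on a Leibniz algebra $(A,\circ_A)$ is left-invariant if $\mathcal{B}(x\circ_A y,z)+\mathcal{B}(y,x\circ_A z)=0$ for all $x,y,z\in A$. A special type-$a$ pre-Leibniz algebra (with $a=\begin{pmatrix}1&-1\\-1&0\end{pmatrix}$) is a vector space $A$ with bilinear multiplications $\succ_A,\prec_A$ such that $\prec_A$ is anticommutative ($x\prec_A y=-y\prec_A x$), $(A,\circ_A)$ with $x\circ_A y:=x\succ_A y+x\prec_A y$ is a Leibniz algebra, and $x\circ_A(y\prec_A z)=(x\circ_A y)\prec_A z+y\prec_A(x\circ_A z)=x\prec_A(y\prec_A z)$ for all $x,y,z\in A$. A symmetric bilinear form $\mathcal{B}$ on it is invariant if $\mathcal{B}(x\prec_A y,z)=-\mathcal{B}(x,z\circ_A y)$ for all $x,y,z\in A$. A quadratic special type-$a$ pre-Leibniz algebra is a special type-$a$ pre-Leibniz algebra together with a nondegenerate symmetric invariant bilinear form. For a vector space $A$ with dual space $A^*$, let $\mathcal{B}_d$ be the natural nondegenerate symmetric bilinear form on $A\oplus A^*$ given by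 $\mathcal{B}_d(x+a^*,y+b^* )=\langle x,b^*\rangle+\langle a^*,y\rangle$ for $x,y\in A$, $a^*,b^*\in A^*$. A Manin triple of Leibniz algebras associated to the nondegenerate symmetric left-invariant bilinear form $\mathcal{B}_d$ is a triple $\big((A\oplus A^*,\circ_d,\mathcal{B}_d),(A,\circ_A),(A^*,\circ_{A^*})\big)$ where $(A,\circ_A)$ and $(A^*,\circ_{A^*})$ are Leibniz algebras, $(A\oplus A^*,\circ_d)$ is a Leibniz algebra containing $(A,\circ_A)$ and $(A^*,\circ_{A^*})$ as Leibniz subalgebras, and $\mathcal{B}_d$ is left-invariant on $(A\oplus A^*,\circ_d)$. A Manin triple of special type-$a$ pre-Leibniz algebras (associated to the nondegenerate symmetric invariant bilinear form $\mathcal{B}_d$) is a triple $\big((A\oplus A^*,\succ_d,\prec_d,\mathcal{B}_d),(A,\succ_A,\prec_A),(A^*,\succ_{A^*},\prec_{A^*})\big)$ where $(A,\succ_A,\prec_A)$ and $(A^*,\succ_{A^*},\prec_{A^*})$ are special type-$a$ pre-Leibniz algebras and $(A\oplus A^*,\succ_d,\prec_d,\mathcal{B}_d)$ is a quadratic special type-$a$ pre-Leibniz algebra containing both of them as special type-$a$ pre-Leibniz subalgebras. *)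

theory Defs
  imports
    "HOL-Analysis.Product_Vector"
    "HOL-Computational_Algebra.Polynomial"
    "HOL-Library.Function_Algebras"
    "HOL-Library.FuncSet"
begin

text \<open>
  The dual space of a vector space is a proper subset of a function type, so an algebra is given
  by a subspace \<open>V\<close> of an ambient vector space together with its multiplications.
  A multiplication is a curried function in \<open>V \<rightarrow>\<^sub>E V \<rightarrow>\<^sub>E V\<close>: it is \<open>undefined\<close> off \<open>V\<close>, so that two
  multiplications are equal as terms exactly when they agree on \<open>V\<close>.
\<close>

definition bilinear_on ::
    "('k::field \<Rightarrow> 'v::ab_group_add \<Rightarrow> 'v) \<Rightarrow> ('k \<Rightarrow> 'w::ab_group_add \<Rightarrow> 'w) \<Rightarrow> 'v set
      \<Rightarrow> ('v \<Rightarrow> 'v \<Rightarrow> 'w) \<Rightarrow> bool"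
  where "bilinear_on s t V m \<longleftrightarrow>
    (\<forall>x\<in>V. \<forall>y\<in>V. \<forall>z\<in>V. m (x + y) z = m x z + m y z \<and> m x (y + z) = m x y + m x z) \<and>
    (\<forall>c. \<forall>x\<in>V. \<forall>y\<in>V. m (s c x) y = t c (m x y) \<and> m x (s c y) = t c (m x y))"

locale leibniz_algebra = vector_space smul
  for smul :: "'k::field \<Rightarrow> 'v::ab_group_add \<Rightarrow> 'v" +
  fixes V :: "'v set" and mul :: "'v \<Rightarrow> 'v \<Rightarrow> 'v"
  assumes subspace_carrier: "subspace V"
    and mult_closed: "mul \<in> V \<rightarrow>\<^sub>E V \<rightarrow>\<^sub>E V"
    and mult_bilinear: "bilinear_on smul smul V mul"
    and leibniz: "\<lbrakk>x \<in> V; y \<in> V; z \<in> V\<rbrakk> \<Longrightarrow>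
      mul x (mul y z) = mul (mul x y) z + mul y (mul x z)"

definition left_invariant ::
    "'v set \<Rightarrow> ('v \<Rightarrow> 'v \<Rightarrow> 'v) \<Rightarrow> ('v \<Rightarrow> 'v \<Rightarrow> 'k::ab_group_add) \<Rightarrow> bool"
  where "left_invariant V mul B \<longleftrightarrow>
    (\<forall>x\<in>V. \<forall>y\<in>V. \<forall>z\<in>V. B (mul x y) z + B y (mul x z) = 0)"

definition sub_adjacent ::
    "'v set \<Rightarrow> ('v \<Rightarrow> 'v \<Rightarrow> 'v) \<Rightarrow> ('v \<Rightarrow> 'v \<Rightarrow> 'v) \<Rightarrow> 'v \<Rightarrow> 'v \<Rightarrow> 'v::plus"
  where "sub_adjacent V succ prec = (\<lambda>x\<in>V. \<lambda>y\<in>V. succ x y + prec x y)"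

text \<open>Special type-\<open>a\<close> pre-Leibniz algebras, where \<open>a\<close> is the matrix with rows \<open>(1, -1)\<close> and \<open>(-1, 0)\<close>.\<close>

locale special_pre_leibniz_algebra = vector_space smul
  for smul :: "'k::field \<Rightarrow> 'v::ab_group_add \<Rightarrow> 'v" +
  fixes V :: "'v set" and succ prec :: "'v \<Rightarrow> 'v \<Rightarrow> 'v"
  assumes subspace_carrier: "subspace V"
    and succ_closed: "succ \<in> V \<rightarrow>\<^sub>E V \<rightarrow>\<^sub>E V"
    and prec_closed: "prec \<in> V \<rightarrow>\<^sub>E V \<rightarrow>\<^sub>E V"
    and succ_bilinear: "bilinear_on smul smul V succ"
    and prec_bilinear: "bilinear_on smul smul V prec"
    and prec_anticommutative: "\<lbrakk>x \<in> V; y \<in> V\<rbrakk> \<Longrightarrow> prec x y = - prec y x"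
    and sub_adjacent_leibniz: "leibniz_algebra smul V (sub_adjacent V succ prec)"
    and circ_prec: "\<lbrakk>x \<in> V; y \<in> V; z \<in> V\<rbrakk> \<Longrightarrow>
      sub_adjacent V succ prec x (prec y z) =
        prec (sub_adjacent V succ prec x y) z + prec y (sub_adjacent V succ prec x z)"
    and circ_prec': "\<lbrakk>x \<in> V; y \<in> V; z \<in> V\<rbrakk> \<Longrightarrow>
      sub_adjacent V succ prec x (prec y z) = prec x (prec y z)"

locale quadratic_special_pre_leibniz_algebra = special_pre_leibniz_algebra smul V succ prec
  for smul :: "'k::field \<Rightarrow> 'v::ab_group_add \<Rightarrow> 'v" and V succ prec +
  fixes B :: "'v \<Rightarrow> 'v \<Rightarrow> 'k"
  assumes form_bilinear: "bilinear_on smul (*) V B"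
    and form_symmetric: "\<lbrakk>x \<in> V; y \<in> V\<rbrakk> \<Longrightarrow> B x y = B y x"
    and form_nondegenerate: "\<lbrakk>x \<in> V; \<And>y. y \<in> V \<Longrightarrow> B x y = 0\<rbrakk> \<Longrightarrow> x = 0"
    and form_invariant: "\<lbrakk>x \<in> V; y \<in> V; z \<in> V\<rbrakk> \<Longrightarrow>
      B (prec x y) z = - B x (sub_adjacent V succ prec z y)"

definition dual_space :: "('k::field \<Rightarrow> 'a::ab_group_add \<Rightarrow> 'a) \<Rightarrow> ('a \<Rightarrow> 'k) set"
  where "dual_space smul = {f. Vector_Spaces.linear smul (*) f}"

definition dual_scale :: "'k::field \<Rightarrow> ('a \<Rightarrow> 'k) \<Rightarrow> 'a \<Rightarrow> 'k"
  where "dual_scale c f = (\<lambda>x. c * f x)"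

definition double_space :: "('k::field \<Rightarrow> 'a::ab_group_add \<Rightarrow> 'a) \<Rightarrow> ('a \<times> ('a \<Rightarrow> 'k)) set"
  where "double_space smul = UNIV \<times> dual_space smul"

abbreviation double_scale ::
    "('k::field \<Rightarrow> 'a::ab_group_add \<Rightarrow> 'a) \<Rightarrow> 'k \<Rightarrow> 'a \<times> ('a \<Rightarrow> 'k) \<Rightarrow> 'a \<times> ('a \<Rightarrow> 'k)"
  where "double_scale smul \<equiv> module_prod.scale smul dual_scale"

definition double_form :: "'a \<times> ('a \<Rightarrow> 'k::field) \<Rightarrow> 'a \<times> ('a \<Rightarrow> 'k) \<Rightarrow> 'k"
  where "double_form u v = snd v (fst u) + snd u (fst v)"

definition extends_along ::
    "('v \<Rightarrow> 'w) \<Rightarrow> 'v set \<Rightarrow> ('v \<Rightarrow> 'v \<Rightarrow> 'v) \<Rightarrow> ('w \<Rightarrow> 'w \<Rightarrow> 'w) \<Rightarrow> bool"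
  where "extends_along \<iota> V m md \<longleftrightarrow> (\<forall>x\<in>V. \<forall>y\<in>V. md (\<iota> x) (\<iota> y) = \<iota> (m x y))"

text \<open>
  The spaces, their scalings and the form of a Manin triple are determined by \<open>A\<close>, so only the
  multiplications are recorded, in the order \<open>A \<oplus> A\<^sup>*\<close>, \<open>A\<close>, \<open>A\<^sup>*\<close>; the space \<open>A\<close> is the whole type \<open>'a\<close>.
\<close>

type_synonym 'v product = "'v \<Rightarrow> 'v \<Rightarrow> 'v"

type_synonym ('k, 'a) mult_triple =
  "('a \<times> ('a \<Rightarrow> 'k)) product \<times> 'a product \<times> ('a \<Rightarrow> 'k) product"

type_synonym ('k, 'a) mult_pair_triple =
  "(('a \<times> ('a \<Rightarrow> 'k)) product \<times> ('a \<times> ('a \<Rightarrow> 'k)) product) \<times>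
   ('a product \<times> 'a product) \<times> (('a \<Rightarrow> 'k) product \<times> ('a \<Rightarrow> 'k) product)"

definition leibniz_manin_triples ::
    "('k::field \<Rightarrow> 'a::ab_group_add \<Rightarrow> 'a) \<Rightarrow> ('k, 'a) mult_triple set"
  where "leibniz_manin_triples smul =
    {(md, mA, mD).
      leibniz_algebra smul UNIV mA \<and>
      leibniz_algebra dual_scale (dual_space smul) mD \<and>
      leibniz_algebra (double_scale smul) (double_space smul) md \<and>
      extends_along (\<lambda>x. (x, 0)) UNIV mA md \<and>
      extends_along (\<lambda>f. (0, f)) (dual_space smul) mD md \<and>
      left_invariant (double_space smul) md double_form}"

definition special_pre_leibniz_manin_triples ::
    "('k::field \<Rightarrow> 'a::ab_group_add \<Rightarrow> 'a) \<Rightarrow> ('k, 'a) mult_pair_triple set"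
  where "special_pre_leibniz_manin_triples smul =
    {((sd, pd), (sA, pA), (sD, pD)).
      special_pre_leibniz_algebra smul UNIV sA pA \<and>
      special_pre_leibniz_algebra dual_scale (dual_space smul) sD pD \<and>
      quadratic_special_pre_leibniz_algebra
        (double_scale smul) (double_space smul) sd pd double_form \<and>
      extends_along (\<lambda>x. (x, 0)) UNIV sA sd \<and>
      extends_along (\<lambda>x. (x, 0)) UNIV pA pd \<and>
      extends_along (\<lambda>f. (0, f)) (dual_space smul) sD sd \<and>
      extends_along (\<lambda>f. (0, f)) (dual_space smul) pD pd}"

text \<open>
  The correspondence keeps \<open>A\<close> fixed and replaces each of the three pre-Leibniz algebras by its
  Leibniz algebra. The inverse recovers \<open>\<prec>\<close> on the double from invariance of the form.
\<close>

definition sub_adjacent_triple ::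
    "('k::field \<Rightarrow> 'a::ab_group_add \<Rightarrow> 'a) \<Rightarrow> ('k, 'a) mult_pair_triple \<Rightarrow> ('k, 'a) mult_triple"
  where "sub_adjacent_triple smul =
    (\<lambda>((sd, pd), (sA, pA), (sD, pD)).
      (sub_adjacent (double_space smul) sd pd,
       sub_adjacent UNIV sA pA,
       sub_adjacent (dual_space smul) sD pD))"

end

theory Submission
  imports Defs
begin

text \<open>
  On a Leibniz algebra with a nondegenerate symmetric left-invariant form \<open>B\<close>, invariance
  \<open>B (x \<prec> y) z = - B x (z \<circ> y)\<close> determines \<open>\<prec>\<close>; the identities required of \<open>\<prec>\<close> are the adjoints of
  left invariance, of the Leibniz identity and of its consequence \<open>(x \<circ> y + y \<circ> x) \<circ> z = 0\<close>.
  Conversely, anticommutativity of \<open>\<prec>\<close> turns invariance into left invariance.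
  Since \<open>A\<close> and \<open>A\<^sup>*\<close> are Lagrangian subalgebras of the double, \<open>B (x \<prec> y) z = 0\<close> for \<open>x, y, z\<close> in
  one of them, so each is closed under \<open>\<prec>\<close> as well.
  Finite dimension enters only through the existence of \<open>\<prec>\<close>: every functional on the double
  must be of the form \<open>B u\<close>, which amounts to reflexivity of \<open>A\<close>.
\<close>

section \<open>Restricted multiplications and the exchange of \<open>succ\<close> for
  \<open>mul\<close>\<close>

lemma product_eqI:
  assumes "m \<in> V \<rightarrow>\<^sub>E V \<rightarrow>\<^sub>E W" "m' \<in> V \<rightarrow>\<^sub>E V \<rightarrow>\<^sub>E W"
    and "\<And>x y. \<lbrakk>x \<in> V; y \<in> V\<rbrakk> \<Longrightarrow> m x y = m' x y"
  shows "m = m'"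
  using assms by (intro PiE_ext[of m V _ m'] PiE_ext[of "m _" V _ "m' _"]) auto

lemma sub_adjacent_apply [simp]:
  "\<lbrakk>x \<in> V; y \<in> V\<rbrakk> \<Longrightarrow> sub_adjacent V succ prec x y = succ x y + prec x y"
  by (simp add: sub_adjacent_def)

text \<open>With \<open>prec\<close> held fixed this is inverse to \<open>sub_adjacent\<close>. A
  special pre-Leibniz algebra is thus determined by its Leibniz product together with
  \<open>prec\<close>.\<close>

definition succ_part ::
    "'v set \<Rightarrow> ('v \<Rightarrow> 'v \<Rightarrow> 'v) \<Rightarrow> ('v \<Rightarrow> 'v \<Rightarrow> 'v) \<Rightarrow> 'v \<Rightarrow> 'v \<Rightarrow> 'v::minus"
  where "succ_part V mul prec = (\<lambda>x\<in>V. \<lambda>y\<in>V. mul x y - prec x y)"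

lemma succ_part_apply [simp]:
  "\<lbrakk>x \<in> V; y \<in> V\<rbrakk> \<Longrightarrow> succ_part V mul prec x y = mul x y - prec x y"
  by (simp add: succ_part_def)

lemma sub_adjacent_succ_part:
  fixes mul :: "'v::group_add \<Rightarrow> 'v \<Rightarrow> 'v"
  assumes "mul \<in> V \<rightarrow>\<^sub>E V \<rightarrow>\<^sub>E W"
  shows "sub_adjacent V (succ_part V mul prec) prec = mul"
proof (rule product_eqI[OF _ assms])
  show "sub_adjacent V (succ_part V mul prec) prec \<in> V \<rightarrow>\<^sub>E V \<rightarrow>\<^sub>E W"
    using assms by (auto simp: sub_adjacent_def PiE_iff)
qed simp

lemma succ_part_sub_adjacent:
  fixes succ :: "'v::group_add \<Rightarrow> 'v \<Rightarrow> 'v"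
  assumes "succ \<in> V \<rightarrow>\<^sub>E V \<rightarrow>\<^sub>E W"
  shows "succ_part V (sub_adjacent V succ prec) prec = succ"
proof (rule product_eqI[OF _ assms])
  show "succ_part V (sub_adjacent V succ prec) prec \<in> V \<rightarrow>\<^sub>E V \<rightarrow>\<^sub>E W"
    using assms by (auto simp: succ_part_def PiE_iff)
qed simp

section \<open>Leibniz algebras with a nondegenerate symmetric left-invariant form\<close>

locale leibniz_form = leibniz_algebra smul V mul
  for smul :: "'k::field \<Rightarrow> 'v::ab_group_add \<Rightarrow> 'v" and V mul +
  fixes B :: "'v \<Rightarrow> 'v \<Rightarrow> 'k"
  assumes form_bilinear: "bilinear_on smul (*) V B"
    and form_symmetric: "\<lbrakk>x \<in> V; y \<in> V\<rbrakk> \<Longrightarrow> B x y = B y x"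
    and form_nondegenerate: "\<lbrakk>x \<in> V; \<And>y. y \<in> V \<Longrightarrow> B x y = 0\<rbrakk> \<Longrightarrow> x = 0"
    and form_left_invariant: "left_invariant V mul B"
begin

lemma mul_in [simp, intro]: "\<lbrakk>x \<in> V; y \<in> V\<rbrakk> \<Longrightarrow> mul x y \<in> V"
  using mult_closed by (auto simp: PiE_iff)

lemma carrier_closed [simp, intro]:
  "0 \<in> V" "\<lbrakk>x \<in> V; y \<in> V\<rbrakk> \<Longrightarrow> x + y \<in> V" "\<lbrakk>x \<in> V; y \<in> V\<rbrakk> \<Longrightarrow> x - y \<in> V"
  "x \<in> V \<Longrightarrow> - x \<in> V" "x \<in> V \<Longrightarrow> smul c x \<in> V"
  using subspace_carrier by (auto intro: subspace_0 subspace_add subspace_diff subspace_neg subspace_scale)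

lemma mul_simps:
  "\<lbrakk>x \<in> V; y \<in> V; z \<in> V\<rbrakk> \<Longrightarrow> mul (x + y) z = mul x z + mul y z"
  "\<lbrakk>x \<in> V; y \<in> V; z \<in> V\<rbrakk> \<Longrightarrow> mul x (y + z) = mul x y + mul x z"
  "\<lbrakk>x \<in> V; y \<in> V\<rbrakk> \<Longrightarrow> mul (smul c x) y = smul c (mul x y)"
  "\<lbrakk>x \<in> V; y \<in> V\<rbrakk> \<Longrightarrow> mul x (smul c y) = smul c (mul x y)"
  using mult_bilinear unfolding bilinear_on_def by auto

lemma form_simps:
  "\<lbrakk>x \<in> V; y \<in> V; z \<in> V\<rbrakk> \<Longrightarrow> B (x + y) z = B x z + B y z"
  "\<lbrakk>x \<in> V; y \<in> V; z \<in> V\<rbrakk> \<Longrightarrow> B x (y + z) = B x y + B x z"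
  "\<lbrakk>x \<in> V; y \<in> V\<rbrakk> \<Longrightarrow> B (smul c x) y = c * B x y"
  "\<lbrakk>x \<in> V; y \<in> V\<rbrakk> \<Longrightarrow> B x (smul c y) = c * B x y"
  using form_bilinear unfolding bilinear_on_def by auto

lemma form_minus [simp]: "\<lbrakk>x \<in> V; y \<in> V\<rbrakk> \<Longrightarrow> B (- x) y = - B x y"
  using form_simps(3)[of x y "-1"] by simp

text \<open>Nondegeneracy applied to the difference. The identities for \<open>prec\<close> below
  are proved by pairing both sides with an arbitrary vector.\<close>

lemma form_eqI:
  assumes "x \<in> V" "y \<in> V" "\<And>z. z \<in> V \<Longrightarrow> B x z = B y z"
  shows "x = y"
proof -
  have "x + - y = 0"
    by (rule form_nondegenerate) (use assms in \<open>auto simp: form_simps simp del: add_uminus_conv_diff\<close>)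
  then show ?thesis by (simp add: eq_neg_iff_add_eq_0)
qed

lemma form_mul: "\<lbrakk>x \<in> V; y \<in> V; z \<in> V\<rbrakk> \<Longrightarrow> B (mul x y) z = - B y (mul x z)"
  using form_left_invariant unfolding left_invariant_def by (simp add: eq_neg_iff_add_eq_0)

text \<open>Adding the Leibniz identity for \<open>x, y, z\<close> to the one for
  \<open>y, x, z\<close> cancels every other term.\<close>

lemma mul_skew: "\<lbrakk>x \<in> V; y \<in> V; z \<in> V\<rbrakk> \<Longrightarrow> mul (mul x y) z + mul (mul y x) z = 0"
  using leibniz[of x y z] leibniz[of y x z] by simp

end

section \<open>The product determined by invariance of the form\<close>

locale leibniz_form_prec = leibniz_form smul V mul B
  for smul :: "'k::field \<Rightarrow> 'v::ab_group_add \<Rightarrow> 'v" and V mul B +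
  fixes prec :: "'v \<Rightarrow> 'v \<Rightarrow> 'v"
  assumes prec_closed: "prec \<in> V \<rightarrow>\<^sub>E V \<rightarrow>\<^sub>E V"
    and form_prec: "\<lbrakk>x \<in> V; y \<in> V; z \<in> V\<rbrakk> \<Longrightarrow> B (prec x y) z = - B x (mul z y)"
begin

lemma prec_in [simp, intro]: "\<lbrakk>x \<in> V; y \<in> V\<rbrakk> \<Longrightarrow> prec x y \<in> V"
  using prec_closed by (auto simp: PiE_iff)

text \<open>The right-hand side of \<open>form_prec\<close> is bilinear in \<open>x\<close> and
  \<open>y\<close>, and nondegeneracy carries this over to \<open>prec\<close>.\<close>

lemma prec_bilinear: "bilinear_on smul smul V prec"
  unfolding bilinear_on_def
  by (auto intro!: form_eqI simp: form_prec form_simps mul_simps)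

text \<open>Symmetry and left invariance give \<open>- B x (mul z y) = B y (mul z x)\<close>, and
  the right side is \<open>- B (prec y x) z\<close>.\<close>

lemma prec_anticommutative:
  assumes "x \<in> V" "y \<in> V"
  shows "prec x y = - prec y x"
  by (rule form_eqI)
    (use assms in \<open>auto simp: form_prec form_mul form_symmetric[of x "mul _ y"]\<close>)

text \<open>Left invariance moves \<open>x\<close> onto \<open>w\<close>, then
  \<open>form_prec\<close> moves \<open>z\<close> there too; the two signs cancel.\<close>

lemma form_mul_prec:
  assumes "x \<in> V" "y \<in> V" "z \<in> V" "w \<in> V"
  shows "B (mul x (prec y z)) w = B y (mul (mul x w) z)"
  using assms by (simp add: form_mul form_prec)

text \<open>Paired with \<open>w\<close>, the three terms become \<open>B y\<close> applied to the
  three terms, up to sign, of the Leibniz identity for \<open>x, w, z\<close>.\<close>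

lemma mul_prec:
  assumes "x \<in> V" "y \<in> V" "z \<in> V"
  shows "mul x (prec y z) = prec (mul x y) z + prec y (mul x z)"
proof (rule form_eqI)
  fix w assume w: "w \<in> V"
  have "B y (mul x (mul w z)) = B y (mul (mul x w) z) + B y (mul w (mul x z))"
    using assms w leibniz[of x w z] by (simp add: form_simps)
  then show "B (mul x (prec y z)) w = B (prec (mul x y) z + prec y (mul x z)) w"
    using assms w by (simp add: form_mul_prec form_simps form_prec form_mul[of x y])
qed (use assms in auto)

text \<open>Paired with \<open>w\<close>, the two sides become \<open>B y (mul (mul x w) z)\<close>
  and \<open>- B y (mul (mul w x) z)\<close>, which agree by \<open>mul_skew\<close>.\<close>

lemma mul_prec':
  assumes "x \<in> V" "y \<in> V" "z \<in> V"
  shows "mul x (prec y z) = prec x (prec y z)"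
proof (rule form_eqI)
  fix w assume w: "w \<in> V"
  have "B (prec x (prec y z)) w = - B (prec (prec y z) x) w"
    using assms w by (subst prec_anticommutative) auto
  also have "\<dots> = - B y (mul (mul w x) z)"
    using assms w by (simp add: form_prec)
  \<comment> \<open>The sign is written as a scalar so that linearity of \<open>B\<close> in its
    second argument, \<open>form_simps(4)\<close>, can extract it.\<close>
  also have "mul (mul w x) z = smul (- 1) (mul (mul x w) z)"
    using mul_skew[OF w assms(1,3)] by (simp add: eq_neg_iff_add_eq_0)
  finally show "B (mul x (prec y z)) w = B (prec x (prec y z)) w"
    using assms w by (simp add: form_mul_prec form_simps del: scale_minus_left)
qed (use assms in auto)

text \<open>Beyond closure and bilinearity, the axioms see \<open>succ\<close> only through its sum
  with \<open>prec\<close>. Taking \<open>succ\<close> to be the difference makes that sum equal to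
  \<open>mul\<close>, and the remaining axioms are the identities above.\<close>

lemma quadratic:
  "quadratic_special_pre_leibniz_algebra smul V (succ_part V mul prec) prec B"
proof -
  have s: "succ_part V mul prec \<in> V \<rightarrow>\<^sub>E V \<rightarrow>\<^sub>E V"
    by (auto simp: succ_part_def)
  have b: "bilinear_on smul smul V (succ_part V mul prec)"
    using mult_bilinear prec_bilinear
    by (auto simp: bilinear_on_def scale_right_diff_distrib)
  have m: "sub_adjacent V (succ_part V mul prec) prec = mul"
    by (rule sub_adjacent_succ_part[OF mult_closed])
  show ?thesis
    by unfold_locales
      ((simp only: m)?, fact mult_closed mult_bilinear leibniz subspace_carrier s b prec_closed prec_bilinear prec_anticommutative
         mul_prec mul_prec' form_bilinear form_symmetric
         form_nondegenerate form_prec)+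
qed

text \<open>By nondegeneracy, invariance fixes the product. This is the source of injectivity of the
  correspondence.\<close>

lemma prec_unique:
  assumes "prec' \<in> V \<rightarrow>\<^sub>E V \<rightarrow>\<^sub>E V"
    and "\<And>x y z. \<lbrakk>x \<in> V; y \<in> V; z \<in> V\<rbrakk> \<Longrightarrow> B (prec' x y) z = - B x (mul z y)"
  shows "prec' = prec"
proof (rule product_eqI[OF assms(1) prec_closed], rule form_eqI)
  fix x y assume xy: "x \<in> V" "y \<in> V"
  show "prec' x y \<in> V"
    using xy assms(1) by (auto simp: PiE_iff)
  show "B (prec' x y) z = B (prec x y) z" if "z \<in> V" for z
    using xy that by (simp add: assms(2) form_prec)
qed auto

text \<open>For \<open>z\<close> in \<open>L\<close>, \<open>B (prec x y) z\<close> is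
  \<open>- B x (mul z y)\<close>, a pairing of two elements of the isotropic subalgebra
  \<open>L\<close>. So \<open>prec x y\<close> is orthogonal to \<open>L\<close> and lies in it by
  maximality.\<close>

lemma prec_in_lagrangian:
  assumes "L \<subseteq> V" "\<And>x y. \<lbrakk>x \<in> L; y \<in> L\<rbrakk> \<Longrightarrow> mul x y \<in> L"
    and isotropic: "\<And>x y. \<lbrakk>x \<in> L; y \<in> L\<rbrakk> \<Longrightarrow> B x y = 0"
    and maximal: "\<And>x. \<lbrakk>x \<in> V; \<And>y. y \<in> L \<Longrightarrow> B x y = 0\<rbrakk> \<Longrightarrow> x \<in> L"
    and "x \<in> L" "y \<in> L"
  shows "prec x y \<in> L"
proof (rule maximal)
  show "prec x y \<in> V" using assms(1,5,6) by auto
  fix z assume "z \<in> L"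
  then show "B (prec x y) z = 0"
    using assms(1,2,5,6) isotropic[of x "mul z y"] by (simp add: form_prec subset_iff)
qed

end

text \<open>For fixed \<open>x\<close> and \<open>y\<close> the map sending \<open>z\<close> to
  \<open>- B x (mul z y)\<close> is a linear functional on \<open>V\<close>; the vector representing
  it serves as \<open>prec x y\<close>.\<close>

lemma (in leibniz_form) ex_prec:
  assumes represent: "\<And>\<phi>. \<lbrakk>\<And>x y. \<lbrakk>x \<in> V; y \<in> V\<rbrakk> \<Longrightarrow> \<phi> (x + y) = \<phi> x + \<phi> y;
      \<And>c x. x \<in> V \<Longrightarrow> \<phi> (smul c x) = c * \<phi> x\<rbrakk> \<Longrightarrow> \<exists>u\<in>V. \<forall>z\<in>V. B u z = \<phi> z"
  obtains prec where "leibniz_form_prec smul V mul B prec"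
proof -
  have "\<forall>x\<in>V. \<forall>y\<in>V. \<exists>u. u \<in> V \<and> (\<forall>z\<in>V. B u z = - B x (mul z y))"
    unfolding Bex_def[symmetric]
    by (intro ballI represent) (auto simp: form_simps mul_simps)
  then obtain p where p: "\<And>x y. \<lbrakk>x \<in> V; y \<in> V\<rbrakk> \<Longrightarrow>
      p x y \<in> V \<and> (\<forall>z\<in>V. B (p x y) z = - B x (mul z y))"
    by metis
  then have "leibniz_form_prec smul V mul B (\<lambda>x\<in>V. \<lambda>y\<in>V. p x y)"
    by unfold_locales auto
  then show ?thesis by (rule that)
qed

section \<open>From a quadratic special pre-Leibniz algebra back to a Leibniz algebra with
  form\<close>

context quadratic_special_pre_leibniz_algebra
begin

text \<open>Invariance is applied to \<open>prec z y\<close> and to \<open>prec y z\<close>, each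
  paired with \<open>x\<close>; anticommutativity equates the results up to sign.\<close>

lemma sub_adjacent_left_invariant: "left_invariant V (sub_adjacent V succ prec) B"
  unfolding left_invariant_def
proof (intro ballI)
  fix x y z assume V: "x \<in> V" "y \<in> V" "z \<in> V"
  have [simp]: "succ a b + prec a b \<in> V" "prec a b \<in> V" if "a \<in> V" "b \<in> V" for a b
    using that succ_closed prec_closed subspace_carrier by (auto simp: PiE_iff intro!: subspace_add)
  have neg: "B (- a) b = - B a b" if "a \<in> V" "b \<in> V" for a b
  proof -
    have "B (smul (-1) a) b = -1 * B a b"
      using form_bilinear that unfolding bilinear_on_def by blast
    then show ?thesis by simp
  qed
  have "- B z (sub_adjacent V succ prec x y) = B (prec z y) x"
    using V by (simp only: form_invariant)
  also have "\<dots> = - B (prec y z) x"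
    using V by (subst prec_anticommutative) (auto simp: neg)
  also have "\<dots> = B y (sub_adjacent V succ prec x z)"
    using V by (simp only: form_invariant minus_minus)
  finally have "B y (sub_adjacent V succ prec x z) = - B z (sub_adjacent V succ prec x y)" ..
  then show "B (sub_adjacent V succ prec x y) z + B y (sub_adjacent V succ prec x z) = 0"
    using V by (simp add: form_symmetric[of "succ x y + prec x y" z])
qed

text \<open>Makes \<open>prec_unique\<close> applicable to the product of a given quadratic
  algebra.\<close>

lemma leibniz_form_prec: "leibniz_form_prec smul V (sub_adjacent V succ prec) B prec"
proof -
  interpret leibniz_algebra smul V "sub_adjacent V succ prec"
    by (rule sub_adjacent_leibniz)
  show ?thesis
    by unfold_locales
      (use form_bilinear form_symmetric form_nondegenerate form_invariant
        prec_closed sub_adjacent_left_invariant in auto)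
qed

end

section \<open>Passing to embedded subalgebras\<close>

lemma special_pre_leibniz_pull_back:
  assumes "special_pre_leibniz_algebra t W sd pd"
    and A: "leibniz_algebra s V mul"
    and "Vector_Spaces.linear s t \<iota>" "inj \<iota>" "\<iota> ` V \<subseteq> W"
    and mul: "extends_along \<iota> V mul (sub_adjacent W sd pd)"
    and p: "p \<in> V \<rightarrow>\<^sub>E V \<rightarrow>\<^sub>E V" and pd: "extends_along \<iota> V p pd"
  shows "special_pre_leibniz_algebra s V (succ_part V mul p) p \<and>
    extends_along \<iota> V (succ_part V mul p) sd"
proof -
  interpret D: special_pre_leibniz_algebra t W sd pd by fact
  interpret A: leibniz_algebra s V mul by fact
  interpret Vector_Spaces.linear s t \<iota> by fact
  have W [simp]: "\<iota> x \<in> W" if "x \<in> V" for x using assms(5) that by auto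
  note [simp] = add diff neg scale
  \<comment> \<open>Injectivity allows an identity on \<open>V\<close> to be checked after applying
    \<open>\<iota>\<close>, where it becomes the corresponding identity on \<open>W\<close>.\<close>
  have eqI: "x = y" if "\<iota> x = \<iota> y" for x y using \<open>inj \<iota>\<close> that by (simp add: inj_eq)
  have V [simp]: "mul x y \<in> V" "p x y \<in> V" if "x \<in> V" "y \<in> V" for x y
    using that A.mult_closed p by (auto simp: PiE_iff)
  have V' [simp]: "x + y \<in> V" "x - y \<in> V" if "x \<in> V" "y \<in> V" for x y
    using that A.subspace_carrier by (auto intro: A.subspace_add A.subspace_diff)
  have V'' [simp]: "s c x \<in> V" if "x \<in> V" for x c
    using that A.subspace_carrier by (auto intro: A.subspace_scale)
  have \<iota>p: "\<iota> (p x y) = pd (\<iota> x) (\<iota> y)" if "x \<in> V" "y \<in> V" for x y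
    using that pd by (simp add: extends_along_def)
  have \<iota>m: "\<iota> (mul x y) = sub_adjacent W sd pd (\<iota> x) (\<iota> y)" if "x \<in> V" "y \<in> V" for x y
    using that mul by (simp add: extends_along_def del: sub_adjacent_apply)
  have ext: "extends_along \<iota> V (succ_part V mul p) sd"
    by (simp add: extends_along_def \<iota>p \<iota>m)
  note [simp] = sub_adjacent_succ_part[OF A.mult_closed]
  have pb: "bilinear_on s s V p"
    using D.prec_bilinear by (auto intro!: eqI simp: bilinear_on_def \<iota>p)
  have sb: "bilinear_on s s V (succ_part V mul p)"
    using pb A.mult_bilinear by (auto simp: bilinear_on_def A.scale_right_diff_distrib)
  have "special_pre_leibniz_algebra s V (succ_part V mul p) p"
  proof unfold_locales
    show "succ_part V mul p \<in> V \<rightarrow>\<^sub>E V \<rightarrow>\<^sub>E V"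
      by (auto simp: succ_part_def)
    fix x y z assume xy: "x \<in> V" "y \<in> V"
    show "p x y = - p y x"
      by (rule eqI) (use xy D.prec_anticommutative[of "\<iota> x" "\<iota> y"] in \<open>simp add: \<iota>p\<close>)
    assume z: "z \<in> V"
    show "sub_adjacent V (succ_part V mul p) p x (p y z) =
        p (sub_adjacent V (succ_part V mul p) p x y) z + p y (sub_adjacent V (succ_part V mul p) p x z)"
      by (rule eqI) (use xy z D.circ_prec in \<open>simp add: \<iota>p \<iota>m del: sub_adjacent_apply\<close>)
    show "sub_adjacent V (succ_part V mul p) p x (p y z) = p x (p y z)"
      by (rule eqI) (use xy z D.circ_prec' in \<open>simp add: \<iota>p \<iota>m del: sub_adjacent_apply\<close>)
  qed ((simp only: sub_adjacent_succ_part[OF A.mult_closed])?,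
      fact A.subspace_carrier p pb sb A.mult_closed A.mult_bilinear A.leibniz)+
  with ext show ?thesis by blast
qed

text \<open>The image of \<open>U\<close> is a Lagrangian subalgebra, hence closed under
  \<open>prec\<close>, so preimages under \<open>\<iota>\<close> define a product on
  \<open>U\<close>. An embedding replaces an inclusion because the space and its dual are not
  literally subsets of the double.\<close>

lemma (in leibniz_form_prec) lagrangian_pull_back:
  assumes A: "leibniz_algebra s U mA"
    and \<iota>: "Vector_Spaces.linear s smul \<iota>" "inj \<iota>" "\<iota> ` U \<subseteq> V"
    and mA: "extends_along \<iota> U mA mul"
    and isotropic: "\<And>x y. \<lbrakk>x \<in> U; y \<in> U\<rbrakk> \<Longrightarrow> B (\<iota> x) (\<iota> y) = 0"
    and maximal: "\<And>x. \<lbrakk>x \<in> V; \<And>y. y \<in> U \<Longrightarrow> B x (\<iota> y) = 0\<rbrakk> \<Longrightarrow> x \<in> \<iota> ` U"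
  obtains sA pA where "special_pre_leibniz_algebra s U sA pA"
    "extends_along \<iota> U sA (succ_part V mul prec)" "extends_along \<iota> U pA prec"
    "sub_adjacent U sA pA = mA"
proof -
  interpret A: leibniz_algebra s U mA by fact
  have m: "mul (\<iota> x) (\<iota> y) \<in> \<iota> ` U" if "x \<in> U" "y \<in> U" for x y
    using that mA A.mult_closed by (auto simp: extends_along_def PiE_iff)
  have "prec x y \<in> \<iota> ` U" if "x \<in> \<iota> ` U" "y \<in> \<iota> ` U" for x y
    by (rule prec_in_lagrangian[OF \<open>\<iota> ` U \<subseteq> V\<close>]) (use that m isotropic maximal in auto)
  then have "\<forall>x\<in>U. \<forall>y\<in>U. \<exists>u. u \<in> U \<and> prec (\<iota> x) (\<iota> y) = \<iota> u"
    by blast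
  then obtain p where p: "\<And>x y. \<lbrakk>x \<in> U; y \<in> U\<rbrakk> \<Longrightarrow> p x y \<in> U \<and> prec (\<iota> x) (\<iota> y) = \<iota> (p x y)"
    by metis
  define pA where "pA = (\<lambda>x\<in>U. \<lambda>y\<in>U. p x y)"
  have pA: "pA \<in> U \<rightarrow>\<^sub>E U \<rightarrow>\<^sub>E U" "extends_along \<iota> U pA prec"
    using p by (auto simp: pA_def extends_along_def)
  interpret D: quadratic_special_pre_leibniz_algebra smul V "succ_part V mul prec" prec B
    by (rule quadratic)
  have "special_pre_leibniz_algebra s U (succ_part U mA pA) pA \<and>
      extends_along \<iota> U (succ_part U mA pA) (succ_part V mul prec)"
    by (rule special_pre_leibniz_pull_back[OF D.special_pre_leibniz_algebra_axioms A \<iota> _ pA])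
      (simp add: sub_adjacent_succ_part[OF mult_closed] mA)
  then show ?thesis
    using that pA sub_adjacent_succ_part[OF A.mult_closed] by blast
qed

lemma extends_along_sub_adjacent:
  assumes "Vector_Spaces.linear s t \<iota>" "\<iota> ` V \<subseteq> W"
    and "extends_along \<iota> V sA sd" "extends_along \<iota> V pA pd"
  shows "extends_along \<iota> V (sub_adjacent V sA pA) (sub_adjacent W sd pd)"
proof -
  interpret Vector_Spaces.linear s t \<iota> by fact
  show ?thesis using assms(2-4) by (auto simp: extends_along_def add image_subset_iff)
qed

text \<open>The products on the two summands are determined by those on the double, so uniqueness
  only has to be settled there.\<close>

lemma extends_along_unique:
  assumes "inj \<iota>" "m \<in> V \<rightarrow>\<^sub>E V \<rightarrow>\<^sub>E V" "m' \<in> V \<rightarrow>\<^sub>E V \<rightarrow>\<^sub>E V"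
    and "extends_along \<iota> V m md" "extends_along \<iota> V m' md"
  shows "m = m'"
  by (rule product_eqI[OF assms(2,3)])
    (use assms in \<open>auto simp: extends_along_def inj_eq dest!: bspec\<close>)

section \<open>The dual space, the double and its form\<close>

context finite_dimensional_vector_space
begin

lemma vector_space_dual: "vector_space (dual_scale :: 'a \<Rightarrow> ('b \<Rightarrow> 'a) \<Rightarrow> _)"
  by unfold_locales (auto simp: dual_scale_def fun_eq_iff algebra_simps)

lemma vector_space_field: "vector_space ((*) :: 'a \<Rightarrow> 'a \<Rightarrow> 'a)"
  by unfold_locales (auto simp: algebra_simps)

text \<open>The second factor is the space of all functions to the field; the dual is a subspace of
  it.\<close>

sublocale double: vector_space_prod scale "dual_scale :: 'a \<Rightarrow> ('b \<Rightarrow> 'a) \<Rightarrow> _"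
  by (intro vector_space_prod.intro vector_space_pair.intro vector_space_axioms vector_space_dual)

lemma dual_space_iff:
  "f \<in> dual_space scale \<longleftrightarrow> (\<forall>x y. f (x + y) = f x + f y) \<and> (\<forall>c x. f (c *s x) = c * f x)"
  by (auto simp: dual_space_def Vector_Spaces.linear_iff vector_space_axioms vector_space_field)

lemma subspace_dual: "double.vs2.subspace (dual_space scale)"
  unfolding double.vs2.subspace_def by (auto simp: dual_space_iff dual_scale_def algebra_simps)

lemma zero_in_dual: "0 \<in> dual_space scale"
  using subspace_dual by (rule double.vs2.subspace_0)

text \<open>For \<open>b\<close> in \<open>Basis\<close> these coordinate functionals make up the
  dual basis.\<close>

lemma coordinate_in_dual: "(\<lambda>x. representation Basis x b) \<in> dual_space scale"
  unfolding dual_space_def mem_Collect_eq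
  by (rule linear_representation[OF independent_Basis span_Basis])

lemma linear_inclusions:
  "Vector_Spaces.linear scale (double_scale scale) (\<lambda>x. (x, 0 :: 'b \<Rightarrow> 'a))"
  "Vector_Spaces.linear dual_scale (double_scale scale) (\<lambda>f. (0, f :: 'b \<Rightarrow> 'a))"
  by (auto simp: Vector_Spaces.linear_iff vector_space_axioms vector_space_dual
      double.p.vector_space_axioms double.scale_prod dual_scale_def fun_eq_iff)

lemma double_form_bilinear: "bilinear_on (double_scale scale) (*) (double_space scale) double_form"
  by (auto simp: bilinear_on_def double_form_def double_space_def double.scale_def
      dual_scale_def dual_space_iff algebra_simps)

text \<open>The coordinates of \<open>x\<close> are values of functionals at \<open>x\<close>, so
  all of them vanish.\<close>

lemma dual_separates:
  assumes "\<And>f. f \<in> dual_space scale \<Longrightarrow> f x = 0"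
  shows "x = 0"
proof -
  have "x = (\<Sum>b\<in>Basis. representation Basis x b *s b)"
    by (rule sum_representation_eq[symmetric])
      (auto simp: independent_Basis span_Basis finite_Basis)
  also have "\<dots> = 0"
    using assms[OF coordinate_in_dual] by simp
  finally show ?thesis .
qed

lemma dual_zero: "f \<in> dual_space scale \<Longrightarrow> f 0 = 0"
  using dual_space_iff[of f] by (metis scale_zero_left mult_zero_left)

text \<open>Pairing \<open>(x, f)\<close> with \<open>(0, g)\<close> yields \<open>g x\<close>, and
  pairing it with \<open>(y, 0)\<close> yields \<open>f y\<close>.\<close>

lemma double_form_nondegenerate:
  assumes "u \<in> double_space scale" "\<And>v. v \<in> double_space scale \<Longrightarrow> double_form u v = 0"
  shows "u = 0"
proof (cases u)
  case (Pair x f)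
  have "x = 0"
    using assms(2)[of "(0, _)"] assms(1) Pair
    by (intro dual_separates) (auto simp: double_form_def double_space_def dual_zero)
  moreover have "f = 0"
    using assms(2)[of "(_, 0)"] Pair subspace_dual
    by (auto simp: double_form_def double_space_def fun_eq_iff double.vs2.subspace_0)
  ultimately show ?thesis using Pair by (simp add: zero_prod_def)
qed

text \<open>Surjectivity of the evaluation map into the bidual, with \<open>\<phi>\<close> assumed
  linear only on the dual space.\<close>

lemma dual_reflexive:
  assumes add: "\<And>f g. \<lbrakk>f \<in> dual_space scale; g \<in> dual_space scale\<rbrakk> \<Longrightarrow> \<phi> (f + g) = \<phi> f + \<phi> g"
    and scl: "\<And>c f. f \<in> dual_space scale \<Longrightarrow> \<phi> (dual_scale c f) = c * \<phi> f"
  obtains x where "\<And>f. f \<in> dual_space scale \<Longrightarrow> f x = \<phi> f"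
proof
  define \<beta> where "\<beta> b = (\<lambda>x. representation Basis x b)" for b
  \<comment> \<open>Since \<open>f\<close> is the sum of \<open>f b\<close> times
    \<open>\<beta> b\<close>, the value \<open>\<phi> f\<close> is the sum of
    \<open>f b * \<phi> (\<beta> b)\<close>. This forces the coordinates
    \<open>\<phi> (\<beta> b)\<close>.\<close>
  define x where "x = (\<Sum>b\<in>Basis. \<phi> (\<beta> b) *s b)"
  have \<beta>: "\<beta> b \<in> dual_space scale" for b
    unfolding \<beta>_def by (rule coordinate_in_dual)
  have \<phi>0: "\<phi> 0 = 0" using add[OF zero_in_dual zero_in_dual]
    by (metis add.right_neutral add_left_cancel)
  fix f assume f: "f \<in> dual_space scale"
  interpret f: Vector_Spaces.linear scale "(*)" f using f by (simp add: dual_space_def)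
  \<comment> \<open>Membership is carried through the induction because additivity of
    \<open>\<phi>\<close> may be used only inside the dual space.\<close>
  have sum\<phi>: "(\<Sum>b\<in>S. dual_scale (f b) (\<beta> b)) \<in> dual_space scale \<and>
      \<phi> (\<Sum>b\<in>S. dual_scale (f b) (\<beta> b)) = (\<Sum>b\<in>S. f b * \<phi> (\<beta> b))" if "finite S" for S
    using that
  proof (induction S)
    case empty
    then show ?case by (simp only: sum.empty zero_in_dual \<phi>0 simp_thms)
  next
    case (insert b S)
    have b: "dual_scale (f b) (\<beta> b) \<in> dual_space scale"
      using subspace_dual \<beta> by (rule double.vs2.subspace_scale)
    have S: "(\<Sum>b\<in>S. dual_scale (f b) (\<beta> b)) \<in> dual_space scale"
      using insert.IH ..
    have "\<phi> (\<Sum>b\<in>insert b S. dual_scale (f b) (\<beta> b)) = (\<Sum>b\<in>insert b S. f b * \<phi> (\<beta> b))"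
      by (simp only: sum.insert[OF insert.hyps] add[OF b S] scl[OF \<beta>] insert.IH)
    moreover have "(\<Sum>b\<in>insert b S. dual_scale (f b) (\<beta> b)) \<in> dual_space scale"
      unfolding sum.insert[OF insert.hyps] using b S by (rule double.vs2.subspace_add[OF subspace_dual])
    ultimately show ?case by (rule conjI[rotated])
  qed
  have "f y = (\<Sum>b\<in>Basis. dual_scale (f b) (\<beta> b)) y" for y
  proof -
    have "f y = f (\<Sum>b\<in>Basis. representation Basis y b *s b)"
      by (subst sum_representation_eq) (auto simp: independent_Basis span_Basis finite_Basis)
    also have "\<dots> = (\<Sum>b\<in>Basis. dual_scale (f b) (\<beta> b) y)"
      by (simp add: f.sum f.scale dual_scale_def \<beta>_def mult.commute)
    also have "\<dots> = (\<Sum>b\<in>Basis. dual_scale (f b) (\<beta> b)) y"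
      using finite_Basis by (induction rule: finite_induct) auto
    finally show ?thesis .
  qed
  then have "f = (\<Sum>b\<in>Basis. dual_scale (f b) (\<beta> b))" by blast
  then have "\<phi> f = (\<Sum>b\<in>Basis. f b * \<phi> (\<beta> b))"
    using sum\<phi>[OF finite_Basis] by simp
  also have "\<dots> = f x"
    by (simp add: x_def f.sum f.scale mult.commute)
  finally show "f x = \<phi> f" ..
qed

text \<open>Supplies the hypothesis of \<open>ex_prec\<close>. In the representing pair
  \<open>(x, g)\<close>, \<open>g\<close> is the restriction of \<open>\<phi>\<close> to the first
  summand, and \<open>x\<close> represents its restriction to the dual by reflexivity.\<close>

lemma double_form_represents:
  assumes add: "\<And>u v. \<lbrakk>u \<in> double_space scale; v \<in> double_space scale\<rbrakk> \<Longrightarrow> \<phi> (u + v) = \<phi> u + \<phi> v"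
    and scl: "\<And>c u. u \<in> double_space scale \<Longrightarrow> \<phi> (double_scale scale c u) = c * \<phi> u"
  shows "\<exists>u\<in>double_space scale. \<forall>v\<in>double_space scale. double_form u v = \<phi> v"
proof -
  have "\<exists>x. \<forall>f\<in>dual_space scale. f x = \<phi> (0, f)"
  proof (rule dual_reflexive[of "\<lambda>f. \<phi> (0, f)"])
    show "\<phi> (0, f + g) = \<phi> (0, f) + \<phi> (0, g)"
      if "f \<in> dual_space scale" "g \<in> dual_space scale" for f g
      using add[of "(0, f)" "(0, g)"] that by (simp add: double_space_def)
    show "\<phi> (0, dual_scale c f) = c * \<phi> (0, f)" if "f \<in> dual_space scale" for c f
      using scl[of "(0, f)" c] that by (simp add: double_space_def double.scale_prod)
  qed blast
  then obtain x where x: "\<And>f. f \<in> dual_space scale \<Longrightarrow> f x = \<phi> (0, f)"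
    by blast
  define g where "g = (\<lambda>y. \<phi> (y, 0))"
  have "g \<in> dual_space scale"
    unfolding dual_space_iff
  proof (intro conjI allI)
    show "g (y + z) = g y + g z" for y z
      using add[of "(y, 0)" "(z, 0)"] zero_in_dual by (simp add: double_space_def g_def)
    show "g (c *s y) = c * g y" for c y
      using scl[of "(y, 0)" c] zero_in_dual by (simp add: double_space_def double.scale_prod g_def)
  qed
  moreover have "double_form (x, g) v = \<phi> v" if v: "v \<in> double_space scale" for v
  proof (cases v)
    case (Pair y f)
    then have "f \<in> dual_space scale" using v by (simp add: double_space_def)
    then show ?thesis
      using Pair add[of "(y, 0)" "(0, f)"] zero_in_dual x
      by (simp add: double_form_def double_space_def g_def)
  qed
  ultimately show ?thesis
    by (intro bexI[of _ "(x, g)"]) (auto simp: double_space_def)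
qed

section \<open>Manin triples and the bijection between them\<close>

lemma manin_leibniz_form:
  assumes "(md, mA, mD) \<in> leibniz_manin_triples scale"
  shows "leibniz_form (double_scale scale) (double_space scale) md double_form"
proof -
  interpret leibniz_algebra "double_scale scale" "double_space scale" md
    using assms by (simp add: leibniz_manin_triples_def)
  have inv: "left_invariant (double_space scale) md double_form"
    using assms by (simp add: leibniz_manin_triples_def)
  have sym: "double_form u v = double_form v u"
    if "u \<in> double_space scale" "v \<in> double_space scale" for u v
    by (simp add: double_form_def add.commute)
  show ?thesis
    by unfold_locales (fact double_form_bilinear double_form_nondegenerate inv sym)+
qed

lemma sub_adjacent_triple_in:
  assumes "T \<in> special_pre_leibniz_manin_triples scale"
  shows "sub_adjacent_triple scale T \<in> leibniz_manin_triples scale"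
proof -
  obtain sd pd sA pA sD pD where T: "T = ((sd, pd), (sA, pA), (sD, pD))"
    by (metis surj_pair)
  interpret D: quadratic_special_pre_leibniz_algebra
      "double_scale scale" "double_space scale" sd pd double_form
    using assms by (simp add: T special_pre_leibniz_manin_triples_def)
  have "extends_along (\<lambda>x. (x, 0)) UNIV (sub_adjacent UNIV sA pA)
      (sub_adjacent (double_space scale) sd pd)"
    by (rule extends_along_sub_adjacent[OF linear_inclusions(1)])
      (use assms in \<open>auto simp: T special_pre_leibniz_manin_triples_def double_space_def zero_in_dual\<close>)
  moreover have "extends_along (\<lambda>f. (0, f)) (dual_space scale) (sub_adjacent (dual_space scale) sD pD)
      (sub_adjacent (double_space scale) sd pd)"
    by (rule extends_along_sub_adjacent[OF linear_inclusions(2)])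
      (use assms in \<open>auto simp: T special_pre_leibniz_manin_triples_def double_space_def\<close>)
  moreover have "leibniz_algebra scale UNIV (sub_adjacent UNIV sA pA)"
      "leibniz_algebra dual_scale (dual_space scale) (sub_adjacent (dual_space scale) sD pD)"
    using assms by (auto simp: T special_pre_leibniz_manin_triples_def
        intro: special_pre_leibniz_algebra.sub_adjacent_leibniz)
  ultimately show ?thesis
    using D.sub_adjacent_leibniz D.sub_adjacent_left_invariant
    by (simp add: T leibniz_manin_triples_def sub_adjacent_triple_def)
qed

text \<open>Equal Leibniz products on the double force equal \<open>prec\<close> by
  \<open>prec_unique\<close>, then equal \<open>succ\<close> by subtraction; the products on the
  summands follow by restriction.\<close>

lemma sub_adjacent_triple_inj:
  "inj_on (sub_adjacent_triple scale) (special_pre_leibniz_manin_triples scale)"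
proof (rule inj_onI)
  fix T T'
  assume mem: "T \<in> special_pre_leibniz_manin_triples scale"
      "T' \<in> special_pre_leibniz_manin_triples scale"
    and eq: "sub_adjacent_triple scale T = sub_adjacent_triple scale T'"
  obtain sd pd sA pA sD pD where T: "T = ((sd, pd), (sA, pA), (sD, pD))"
    by (metis surj_pair)
  obtain sd' pd' sA' pA' sD' pD' where T': "T' = ((sd', pd'), (sA', pA'), (sD', pD'))"
    by (metis surj_pair)
  let ?D = "double_space scale"
  interpret D: quadratic_special_pre_leibniz_algebra "double_scale scale" ?D sd pd double_form
    using mem by (simp add: T special_pre_leibniz_manin_triples_def)
  interpret D': quadratic_special_pre_leibniz_algebra "double_scale scale" ?D sd' pd' double_form
    using mem by (simp add: T' special_pre_leibniz_manin_triples_def)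
  have md: "sub_adjacent ?D sd' pd' = sub_adjacent ?D sd pd"
    using eq by (simp add: T T' sub_adjacent_triple_def)
  have pd: "pd' = pd"
    by (rule leibniz_form_prec.prec_unique[OF D.leibniz_form_prec D'.prec_closed])
      (simp only: D'.form_invariant flip: md)
  have "sd' = succ_part ?D (sub_adjacent ?D sd' pd') pd'"
    by (rule succ_part_sub_adjacent[OF D'.succ_closed, symmetric])
  also have "\<dots> = sd"
    unfolding md unfolding pd by (rule succ_part_sub_adjacent[OF D.succ_closed])
  finally have sd: "sd' = sd" .
  have A: "special_pre_leibniz_algebra scale UNIV sA pA"
      "special_pre_leibniz_algebra scale UNIV sA' pA'"
      "extends_along (\<lambda>x. (x, 0)) UNIV sA sd" "extends_along (\<lambda>x. (x, 0)) UNIV pA pd"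
      "extends_along (\<lambda>x. (x, 0)) UNIV sA' sd" "extends_along (\<lambda>x. (x, 0)) UNIV pA' pd"
    using mem unfolding T T' sd pd by (simp_all add: special_pre_leibniz_manin_triples_def)
  have D: "special_pre_leibniz_algebra dual_scale (dual_space scale) sD pD"
      "special_pre_leibniz_algebra dual_scale (dual_space scale) sD' pD'"
      "extends_along (\<lambda>f. (0, f)) (dual_space scale) sD sd"
      "extends_along (\<lambda>f. (0, f)) (dual_space scale) pD pd"
      "extends_along (\<lambda>f. (0, f)) (dual_space scale) sD' sd"
      "extends_along (\<lambda>f. (0, f)) (dual_space scale) pD' pd"
    using mem unfolding T T' sd pd by (simp_all add: special_pre_leibniz_manin_triples_def)
  note closed = special_pre_leibniz_algebra.succ_closed special_pre_leibniz_algebra.prec_closed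
  have "sA = sA'" "pA = pA'"
    by (rule extends_along_unique[OF _ _ _ A(3,5)] extends_along_unique[OF _ _ _ A(4,6)];
        use closed[OF A(1)] closed[OF A(2)] in \<open>auto intro: injI\<close>)+
  moreover have "sD = sD'" "pD = pD'"
    by (rule extends_along_unique[OF _ _ _ D(3,5)] extends_along_unique[OF _ _ _ D(4,6)];
        use closed[OF D(1)] closed[OF D(2)] in \<open>auto intro: injI\<close>)+
  ultimately show "T = T'"
    by (simp add: T T' sd pd)
qed

text \<open>Representability of functionals yields \<open>prec\<close> on the double, and both
  summands inherit it because they are Lagrangian.\<close>

lemma sub_adjacent_triple_surj:
  assumes "M \<in> leibniz_manin_triples scale"
  shows "M \<in> sub_adjacent_triple scale ` special_pre_leibniz_manin_triples scale"
proof -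
  obtain md mA mD where M: "M = (md, mA, mD)"
    by (metis surj_pair)
  have A: "leibniz_algebra scale UNIV mA" "extends_along (\<lambda>x. (x, 0)) UNIV mA md"
    and D: "leibniz_algebra dual_scale (dual_space scale) mD"
      "extends_along (\<lambda>f. (0, f)) (dual_space scale) mD md"
    using assms by (simp_all add: M leibniz_manin_triples_def)
  let ?D = "double_space scale"
  interpret F: leibniz_form "double_scale scale" ?D md double_form
    using assms unfolding M by (rule manin_leibniz_form)
  have "\<exists>pd. leibniz_form_prec (double_scale scale) ?D md double_form pd"
    by (rule F.ex_prec[OF double_form_represents]) blast+
  then obtain pd where "leibniz_form_prec (double_scale scale) ?D md double_form pd" ..
  then interpret P: leibniz_form_prec "double_scale scale" ?D md double_form pd .
  let ?sd = "succ_part ?D md pd"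
  obtain sA pA where A': "special_pre_leibniz_algebra scale UNIV sA pA"
    "extends_along (\<lambda>x. (x, 0)) UNIV sA ?sd" "extends_along (\<lambda>x. (x, 0)) UNIV pA pd"
    "sub_adjacent UNIV sA pA = mA"
  proof (rule P.lagrangian_pull_back[OF A(1) linear_inclusions(1) _ _ A(2)])
    \<comment> \<open>Orthogonality of \<open>(a, f)\<close> to every \<open>(y, 0)\<close> says
      that \<open>f\<close> vanishes.\<close>
    show "u \<in> range (\<lambda>x. (x, 0))"
      if "u \<in> ?D" "\<And>y. y \<in> UNIV \<Longrightarrow> double_form u (y, 0) = 0" for u
      using that by (cases u) (auto simp: double_form_def double_space_def dual_zero fun_eq_iff)
  qed (auto intro: injI simp: double_form_def double_space_def zero_in_dual)
  obtain sD pD where D': "special_pre_leibniz_algebra dual_scale (dual_space scale) sD pD"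
    "extends_along (\<lambda>f. (0, f)) (dual_space scale) sD ?sd"
    "extends_along (\<lambda>f. (0, f)) (dual_space scale) pD pd"
    "sub_adjacent (dual_space scale) sD pD = mD"
  proof (rule P.lagrangian_pull_back[OF D(1) linear_inclusions(2) _ _ D(2)])
    \<comment> \<open>Here the first component is annihilated by every functional, so finite
      dimension makes it zero.\<close>
    show "u \<in> (\<lambda>f. (0, f)) ` dual_space scale"
      if "u \<in> ?D" "\<And>f. f \<in> dual_space scale \<Longrightarrow> double_form u (0, f) = 0" for u
    proof -
      have "fst u = 0"
        using that by (intro dual_separates) (auto simp: double_form_def double_space_def dual_zero)
      with that(1) show ?thesis by (cases u) (auto simp: double_space_def)
    qed
  qed (auto intro: injI simp: double_form_def double_space_def dual_zero)
  have "((?sd, pd), (sA, pA), (sD, pD)) \<in> special_pre_leibniz_manin_triples scale"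
    using A' D' P.quadratic by (simp add: special_pre_leibniz_manin_triples_def)
  moreover have "sub_adjacent_triple scale ((?sd, pd), (sA, pA), (sD, pD)) = M"
    using A' D' by (simp add: M sub_adjacent_triple_def sub_adjacent_succ_part[OF F.mult_closed])
  ultimately show ?thesis by (metis imageI)
qed

end

theorem proposition4p7:
  fixes smul :: "'k::{alg_closed_field, field_char_0} \<Rightarrow> 'a::ab_group_add \<Rightarrow> 'a"
    and Basis :: "'a set"
  assumes "finite_dimensional_vector_space smul Basis"
  shows "bij_betw (sub_adjacent_triple smul)
    (special_pre_leibniz_manin_triples smul) (leibniz_manin_triples smul)"
proof -
  interpret finite_dimensional_vector_space smul Basis by fact
  show ?thesis
    unfolding bij_betw_def
    using sub_adjacent_triple_inj sub_adjacent_triple_in sub_adjacent_triple_surj by blast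
qed

end
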